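(* Let $m$ be a positive integer. Every graph $G$ of order at least two with at least $m(|V(G)|-1)+1$ edges has an $m^+$-tree-connected subgraph with at least two vertices.
   Context: Graphs are finite, loopless, and may have multiple edges. A graph is $m$-tree-connected if it contains $m$ pairwise edge-disjoint spanning trees. A graph is $m^+$-tree-connected if it has at least one edge and $G-e$ is $m$-tree-connected for every edge $e$ of $G$. *)

theory Defs
  imports Main "HOL-Library.Disjoint_Sets"
begin

text \<open>
  Undirected multigraphs: edges are abstract objects, and \<open>mends\<close> assigns to each edge the set of
  its two endpoints, so parallel edges are distinct elements of \<open>medges G\<close>. The AFP entry
  \<open>Graph_Theory\<close> works with digraphs and directed cycles, and undirected parallel edges
  cannot be represented faithfully by its notion of forest.
\<close>

record ('v, 'e) mgraph =
  mverts :: "'v set"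
  medges :: "'e set"
  mends  :: "'e \<Rightarrow> 'v set"

locale multigraph =
  fixes G :: "('v, 'e) mgraph"
  assumes finite_mverts: "finite (mverts G)"
    and finite_medges: "finite (medges G)"
    and mends_subset: "e \<in> medges G \<Longrightarrow> mends G e \<subseteq> mverts G"
    and no_loops: "e \<in> medges G \<Longrightarrow> card (mends G e) = 2"

text \<open>The values of \<open>mends\<close> outside the edge set of the subgraph are irrelevant.\<close>

definition mg_subgraph :: "('v, 'e) mgraph \<Rightarrow> ('v, 'e) mgraph \<Rightarrow> bool" where
  "mg_subgraph H G \<longleftrightarrow>
     multigraph H \<and> multigraph G \<and> mverts H \<subseteq> mverts G \<and> medges H \<subseteq> medges G \<and>
     (\<forall>e\<in>medges H. mends H e = mends G e)"

definition mg_del_edge :: "('v, 'e) mgraph \<Rightarrow> 'e \<Rightarrow> ('v, 'e) mgraph" where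
  "mg_del_edge G e = G\<lparr>medges := medges G - {e}\<rparr>"

definition mg_adj :: "('v, 'e) mgraph \<Rightarrow> ('v \<times> 'v) set" where
  "mg_adj G = {(u, v). \<exists>e\<in>medges G. mends G e = {u, v}}"

definition mg_connected :: "('v, 'e) mgraph \<Rightarrow> bool" where
  "mg_connected G \<longleftrightarrow>
     mverts G \<noteq> {} \<and> (\<forall>u\<in>mverts G. \<forall>v\<in>mverts G. (u, v) \<in> (mg_adj G)\<^sup>*)"

text \<open>
  A cycle with vertices \<open>vs\<close> and edges \<open>es\<close>, each listed once in cyclic order; two parallel edges
  form a cycle of length 2.
\<close>

definition mg_cycle :: "('v, 'e) mgraph \<Rightarrow> 'v list \<Rightarrow> 'e list \<Rightarrow> bool" where
  "mg_cycle G vs es \<longleftrightarrow>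
     2 \<le> length vs \<and> length es = length vs \<and> distinct vs \<and> distinct es \<and>
     set es \<subseteq> medges G \<and>
     (\<forall>i<length vs. mends G (es ! i) = {vs ! i, vs ! (Suc i mod length vs)})"

definition mg_tree :: "('v, 'e) mgraph \<Rightarrow> bool" where
  "mg_tree T \<longleftrightarrow> multigraph T \<and> mg_connected T \<and> (\<nexists>vs es. mg_cycle T vs es)"

definition mg_spanning_tree :: "('v, 'e) mgraph \<Rightarrow> ('v, 'e) mgraph \<Rightarrow> bool" where
  "mg_spanning_tree T G \<longleftrightarrow> mg_tree T \<and> mg_subgraph T G \<and> mverts T = mverts G"

text \<open>
  The spanning trees form an indexed family, so that the graph with a single vertex is
  \<open>m\<close>-tree-connected for every \<open>m\<close>, as is customary.
\<close>

definition tree_connected :: "nat \<Rightarrow> ('v, 'e) mgraph \<Rightarrow> bool" where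
  "tree_connected m G \<longleftrightarrow>
     (\<exists>T :: nat \<Rightarrow> ('v, 'e) mgraph.
        (\<forall>i<m. mg_spanning_tree (T i) G) \<and> disjoint_family_on (\<lambda>i. medges (T i)) {..<m})"

definition plus_tree_connected :: "nat \<Rightarrow> ('v, 'e) mgraph \<Rightarrow> bool" where
  "plus_tree_connected m G \<longleftrightarrow>
     medges G \<noteq> {} \<and> (\<forall>e\<in>medges G. tree_connected m (mg_del_edge G e))"

end

theory Submission
  imports Defs
begin

text \<open>
  Take \<open>m\<close> disjoint forests of \<open>G\<close> with as many edges as possible. As each has at most
  \<open>card (mverts G) - 1\<close> edges, some edge \<open>e0\<close> is left out. By maximality the left-out edge always
  closes a cycle with each forest, and it may be exchanged for any other edge of that cycle. Let
  \<open>A\<close> be the set of all edges that can become the left-out one by repeated exchanges. All these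
  cycles lie inside \<open>A\<close>, so an exchange does not change the connectivity of the part of a forest
  inside \<open>A\<close>; since each edge of \<open>A\<close> is left out at some stage, these parts always connect the ends
  of every edge of \<open>A\<close>. Hence in the component of \<open>A\<close> containing \<open>e0\<close>, every edge \<open>e\<close> is avoided by
  \<open>m\<close> disjoint spanning trees, namely those present when \<open>e\<close> is left out.
\<close>

section \<open>Connectivity and spanning by edge sets\<close>

context multigraph
begin

definition conn :: "'e set \<Rightarrow> ('v \<times> 'v) set" where
  "conn F = {(u, v). \<exists>e\<in>F. mends G e = {u, v}}\<^sup>*"

text \<open>The closure relation of the graphic matroid of \<open>G\<close>. Taking the product of
  \<open>mends G e\<close> with itself avoids choosing an order of the two ends.\<close>

definition spans :: "'e set \<Rightarrow> 'e \<Rightarrow> bool" where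
  "spans F e \<longleftrightarrow> mends G e \<times> mends G e \<subseteq> conn F"

text \<open>Independence in the graphic matroid; cycles as lists enter only in
  \<open>forest_no_cycle\<close>.\<close>

definition forest :: "'e set \<Rightarrow> bool" where
  "forest F \<longleftrightarrow> F \<subseteq> medges G \<and> (\<forall>f\<in>F. \<not> spans (F - {f}) f)"

lemma conn_refl [simp]: "(u, u) \<in> conn F"
  by (simp add: conn_def)

lemma conn_sym: "(u, v) \<in> conn F \<Longrightarrow> (v, u) \<in> conn F"
  unfolding conn_def
  by (rule symD[OF sym_rtrancl]) (auto simp: sym_def insert_commute)

lemma conn_trans: "(u, v) \<in> conn F \<Longrightarrow> (v, w) \<in> conn F \<Longrightarrow> (u, w) \<in> conn F"
  unfolding conn_def by (rule rtrancl_trans)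

lemma conn_edge: "e \<in> F \<Longrightarrow> mends G e = {u, v} \<Longrightarrow> (u, v) \<in> conn F"
  unfolding conn_def by blast

lemma conn_mono: "F \<subseteq> K \<Longrightarrow> conn F \<subseteq> conn K"
  unfolding conn_def by (rule rtrancl_mono) blast

lemma conn_induct [consumes 1, case_names refl step]:
  assumes "(u, v) \<in> conn F"
    and "P u"
    and "\<And>x y e. (u, x) \<in> conn F \<Longrightarrow> e \<in> F \<Longrightarrow> mends G e = {x, y} \<Longrightarrow> P x \<Longrightarrow> P y"
  shows "P v"
  using assms(1) unfolding conn_def
proof (induction rule: rtrancl_induct)
  case base
  show ?case by (rule assms(2))
next
  case (step x y)
  then show ?case using assms(3)[of x _ y] unfolding conn_def by blast
qed

lemma conn_subset_if_spans:
  assumes "\<And>f. f \<in> F \<Longrightarrow> spans K f"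
  shows "conn F \<subseteq> conn K"
proof clarify
  fix u v assume "(u, v) \<in> conn F"
  then show "(u, v) \<in> conn K"
  proof (induction rule: conn_induct)
    case (step x y e)
    then have "(x, y) \<in> conn K" using assms[of e] unfolding spans_def by auto
    with step.IH show ?case by (rule conn_trans)
  qed simp
qed

lemma spans_iff:
  assumes "mends G e = {u, v}"
  shows "spans F e \<longleftrightarrow> (u, v) \<in> conn F"
  using assms conn_sym[of u v F] by (auto simp: spans_def)

lemma spans_mono: "spans F e \<Longrightarrow> F \<subseteq> K \<Longrightarrow> spans K e"
  using conn_mono unfolding spans_def by blast

lemma edge_ends:
  assumes "e \<in> medges G"
  obtains u v where "mends G e = {u, v}" "u \<noteq> v" "u \<in> mverts G" "v \<in> mverts G"
  using no_loops[OF assms] mends_subset[OF assms] by (auto simp: card_2_iff)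

lemma spans_member: "e \<in> F \<Longrightarrow> e \<in> medges G \<Longrightarrow> spans F e"
  by (metis edge_ends spans_iff conn_edge)

text \<open>A walk needs \<open>f\<close> at most once: a second crossing either undoes the first or
  closes a detour that can be cut out.\<close>

lemma conn_insert_cases:
  assumes "mends G f = {a, b}" "(u, v) \<in> conn (insert f F)"
  shows "(u, v) \<in> conn F \<or> (u, a) \<in> conn F \<and> (b, v) \<in> conn F \<or>
    (u, b) \<in> conn F \<and> (a, v) \<in> conn F"
  using assms(2)
proof (induction rule: conn_induct)
  case (step x y e)
  show ?case
  proof (cases "e \<in> F")
    case True
    then have "(x, y) \<in> conn F" using step by (blast intro: conn_edge)
    with step.IH conn_trans[of _ x F y] show ?thesis by blast
  next
    case False
    with step assms(1) have "{x, y} = {a, b}" by auto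
    then consider "x = a" "y = b" | "x = b" "y = a" by (auto simp: doubleton_eq_iff)
    then show ?thesis
      using step.IH by cases auto
  qed
qed simp

text \<open>Matroid exchange: a walk in \<open>insert f F\<close> between the ends of
  \<open>e\<close> has to cross \<open>f\<close>, and its two remaining pieces joined by
  \<open>e\<close> connect the ends of \<open>f\<close>.\<close>

lemma spans_exchange:
  assumes "e \<in> medges G" "f \<in> medges G" "spans (insert f F) e" "\<not> spans F e"
  shows "spans (insert e F) f"
proof -
  obtain u v where e: "mends G e = {u, v}" using edge_ends[OF assms(1)] .
  obtain a b where f: "mends G f = {a, b}" using edge_ends[OF assms(2)] .
  have mono: "conn F \<subseteq> conn (insert e F)" by (rule conn_mono) blast
  have uv: "(u, v) \<in> conn (insert e F)" using insertI1 e by (rule conn_edge)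
  have "(u, a) \<in> conn F \<and> (b, v) \<in> conn F \<or> (u, b) \<in> conn F \<and> (a, v) \<in> conn F"
    using conn_insert_cases[OF f, of u v F] assms(3,4) by (simp add: spans_iff[OF e])
  then consider "(u, a) \<in> conn (insert e F)" "(b, v) \<in> conn (insert e F)"
    | "(u, b) \<in> conn (insert e F)" "(a, v) \<in> conn (insert e F)"
    using mono by blast
  then have "(a, b) \<in> conn (insert e F)"
  proof cases
    case 1
    show ?thesis by (rule conn_trans[OF conn_sym[OF 1(1)] conn_trans[OF uv conn_sym[OF 1(2)]]])
  next
    case 2
    show ?thesis by (rule conn_trans[OF 2(2) conn_trans[OF conn_sym[OF uv] 2(1)]])
  qed
  then show ?thesis by (simp add: spans_iff[OF f])
qed

section \<open>Forests, their size and their cycles with a further edge\<close>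

lemma forest_subset: "forest F \<Longrightarrow> K \<subseteq> F \<Longrightarrow> forest K"
  unfolding forest_def by (meson Diff_mono order_refl order_trans spans_mono subsetD)

lemma forest_finite: "forest F \<Longrightarrow> finite F"
  unfolding forest_def using finite_medges finite_subset by blast

text \<open>If adding \<open>e\<close> closed a cycle through some \<open>f\<close> of
  \<open>F\<close>, exchanging the two would show that \<open>F\<close> spans
  \<open>e\<close>.\<close>

lemma forest_insert:
  assumes "forest F" "e \<in> medges G" "\<not> spans F e"
  shows "forest (insert e F)"
proof -
  have F: "F \<subseteq> medges G" "\<And>f. f \<in> F \<Longrightarrow> \<not> spans (F - {f}) f"
    using assms(1) by (auto simp: forest_def)
  have "e \<notin> F" using assms spans_member by blast
  have "\<not> spans (insert e F - {f}) f" if "f \<in> F" for f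
  proof
    assume "spans (insert e F - {f}) f"
    moreover have "insert e F - {f} = insert e (F - {f})" using that \<open>e \<notin> F\<close> by blast
    ultimately have "spans (insert f (F - {f})) e"
      using spans_exchange[of f e "F - {f}"] F that assms(2) by auto
    then show False using assms(3) that by (simp add: insert_absorb)
  qed
  with F \<open>e \<notin> F\<close> assms show ?thesis by (auto simp: forest_def)
qed

text \<open>The set \<open>S\<close> consists of one vertex from each component.\<close>

lemma forest_representatives:
  assumes "forest F"
  shows "\<exists>S\<subseteq>mverts G. card S + card F = card (mverts G) \<and>
    (\<forall>v\<in>mverts G. \<exists>s\<in>S. (v, s) \<in> conn F)"
  using forest_finite[OF assms] assms
proof (induction F rule: finite_induct)
  case empty
  show ?case by (rule exI[of _ "mverts G"]) (auto intro: conn_refl)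
next
  case (insert e F)
  obtain S where S: "S \<subseteq> mverts G" "card S + card F = card (mverts G)"
      "\<forall>v\<in>mverts G. \<exists>s\<in>S. (v, s) \<in> conn F"
    using insert.IH forest_subset[OF insert.prems] by blast
  obtain u v where e: "mends G e = {u, v}" "u \<in> mverts G" "v \<in> mverts G"
    using insert.prems unfolding forest_def by (meson edge_ends insert_subset)
  \<comment> \<open>\<open>e\<close> merges the components represented by \<open>s\<close> and
    \<open>t\<close>; dropping \<open>t\<close> makes up for the additional edge.\<close>
  obtain s t where st: "s \<in> S" "(u, s) \<in> conn F" "t \<in> S" "(v, t) \<in> conn F"
    using S(3) e by blast
  have "(u, v) \<notin> conn F"
    using insert.prems insert.hyps by (auto simp: forest_def spans_iff[OF e(1)])
  then have "s \<noteq> t" using st(2) conn_trans[OF _ conn_sym[OF st(4)]] by blast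
  have mono: "conn F \<subseteq> conn (insert e F)" by (rule conn_mono) blast
  have "(t, s) \<in> conn (insert e F)"
    using mono st(2,4) conn_trans[OF conn_sym conn_trans[OF conn_sym[OF conn_edge[OF insertI1 e(1)]]]]
    by blast
  then have "\<exists>r\<in>S - {t}. (w, r) \<in> conn (insert e F)" if w: "w \<in> mverts G" for w
  proof -
    obtain r where r: "r \<in> S" "(w, r) \<in> conn F" using S(3) w by blast
    have wr: "(w, r) \<in> conn (insert e F)" by (rule subsetD[OF mono r(2)])
    show ?thesis
    proof (cases "r = t")
      case True
      with wr \<open>(t, s) \<in> conn (insert e F)\<close> have "(w, s) \<in> conn (insert e F)"
        by (simp add: conn_trans[of w t])
      then show ?thesis using st(1) \<open>s \<noteq> t\<close> by blast
    qed (use r(1) wr in blast)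
  qed
  moreover have "finite S" using S(1) finite_mverts finite_subset by blast
  then have "card (S - {t}) + card (insert e F) = card (mverts G)"
    using S(2) card.remove[OF _ st(3)] card_insert_disjoint[OF insert.hyps(1,2)] by fastforce
  ultimately show ?case using S(1) by (intro exI[of _ "S - {t}"]) blast
qed

lemma card_forest_le:
  assumes "forest F" "mverts G \<noteq> {}"
  shows "card F \<le> card (mverts G) - 1"
proof -
  obtain S where S: "S \<subseteq> mverts G" "card S + card F = card (mverts G)"
      "\<forall>v\<in>mverts G. \<exists>s\<in>S. (v, s) \<in> conn F"
    using forest_representatives[OF assms(1)] by blast
  then have "card S > 0"
    using assms(2) finite_mverts finite_subset by (fastforce simp: card_gt_0_iff)
  with S show ?thesis by linarith
qed

text \<open>The edges \<open>f\<close> of \<open>F\<close> in the conclusion form the cycle closed by \<open>e\<close>.\<close>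

lemma fundamental_cycle:
  assumes "forest F" "e \<in> medges G" "spans F e"
  shows "spans {f \<in> F. \<not> spans (F - {f}) e} e"
proof -
  obtain C where C: "C \<subseteq> F" "spans C e"
      and min: "\<And>K. K \<subset> C \<Longrightarrow> \<not> spans K e"
  proof -
    \<comment> \<open>A spanning subset of least cardinality is minimal under inclusion, as
      \<open>F\<close> is finite.\<close>
    have "\<exists>C. (C \<subseteq> F \<and> spans C e) \<and> (\<forall>K. K \<subseteq> F \<and> spans K e \<longrightarrow> card C \<le> card K)"
      using assms(3) by (intro ex_has_least_nat[of "\<lambda>C. C \<subseteq> F \<and> spans C e"]) blast
    then obtain C where C: "C \<subseteq> F" "spans C e"
        "\<And>K. K \<subseteq> F \<Longrightarrow> spans K e \<Longrightarrow> card C \<le> card K" by blast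
    moreover have "finite C" using C(1) forest_finite[OF assms(1)] finite_subset by blast
    ultimately show thesis using that[of C] by (meson leD psubset_card_mono psubset_imp_subset subset_trans)
  qed
  \<comment> \<open>By minimality of \<open>C\<close>, \<open>f\<close> is spanned by
    \<open>e\<close> and the rest of \<open>C\<close>. If \<open>F - {f}\<close> spanned
    \<open>e\<close>, it would span all of these and hence \<open>f\<close>, against
    \<open>forest F\<close>.\<close>
  have "\<not> spans (F - {f}) e" if f: "f \<in> C" for f
  proof
    assume span: "spans (F - {f}) e"
    have "f \<in> medges G" using f C(1) assms(1) by (auto simp: forest_def)
    then have "spans (insert e (C - {f})) f"
      using spans_exchange[of e f "C - {f}"] assms(2) C(2) min[of "C - {f}"] f
      by (auto simp: insert_absorb)
    moreover have "spans (F - {f}) g" if "g \<in> insert e (C - {f})" for g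
    proof (cases "g = e")
      case False
      with that C(1) assms(1) show ?thesis by (intro spans_member) (auto simp: forest_def)
    qed (use span in simp)
    then have "conn (insert e (C - {f})) \<subseteq> conn (F - {f})" by (rule conn_subset_if_spans)
    ultimately have "spans (F - {f}) f" by (auto simp: spans_def)
    then show False using f C(1) assms(1) by (auto simp: forest_def)
  qed
  then show ?thesis using C by (intro spans_mono[OF C(2)]) blast
qed

section \<open>Maximum packings of \<open>m\<close> forests\<close>

definition forest_packing :: "nat \<Rightarrow> (nat \<Rightarrow> 'e set) \<Rightarrow> bool" where
  "forest_packing m F \<longleftrightarrow> (\<forall>i<m. forest (F i)) \<and> disjoint_family_on F {..<m}"

text \<open>The union of such a packing is a basis of the \<open>m\<close>-fold union of the graphic
  matroid.\<close>

definition maximum_packing :: "nat \<Rightarrow> (nat \<Rightarrow> 'e set) \<Rightarrow> bool" where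
  "maximum_packing m F \<longleftrightarrow> forest_packing m F \<and>
     (\<forall>K. forest_packing m K \<longrightarrow> (\<Sum>i<m. card (K i)) \<le> (\<Sum>i<m. card (F i)))"

lemma packing_size_le:
  assumes "forest_packing m F" "mverts G \<noteq> {}"
  shows "(\<Sum>i<m. card (F i)) \<le> m * (card (mverts G) - 1)"
proof -
  have "(\<Sum>i<m. card (F i)) \<le> (\<Sum>i<m. card (mverts G) - 1)"
    using assms card_forest_le by (intro sum_mono) (auto simp: forest_packing_def)
  then show ?thesis by simp
qed

lemma ex_maximum_packing:
  assumes "mverts G \<noteq> {}"
  shows "\<exists>F. maximum_packing m F"
proof -
  have "forest_packing m (\<lambda>_. {})"
    by (auto simp: forest_packing_def forest_def disjoint_family_on_def)
  moreover have "\<forall>F. forest_packing m F \<longrightarrow> (\<Sum>i<m. card (F i)) < m * (card (mverts G) - 1) + 1"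
    using packing_size_le[OF _ assms] by (auto simp: less_Suc_eq_le)
  ultimately show ?thesis
    unfolding maximum_packing_def by (rule ex_has_greatest_nat)
qed

text \<open>Only \<open>e\<close> can be new in \<open>K\<close>, and no forest contains it, so
  disjointness survives. This serves both for adding an edge and for exchanging one.\<close>

lemma forest_packing_update:
  assumes "forest_packing m F" "i < m" "forest K" "K \<subseteq> insert e (F i)" "\<forall>j<m. e \<notin> F j"
  shows "forest_packing m (F(i := K))"
proof -
  have "F j \<inter> F k = {}" if "j < m" "k < m" "j \<noteq> k" for j k
    using assms(1) that by (auto simp: forest_packing_def disjoint_family_on_def)
  then have "(F(i := K)) j \<inter> (F(i := K)) k = {}" if "j < m" "k < m" "j \<noteq> k" for j k
    using that assms(4,5) by (cases "j = i"; cases "k = i"; simp; blast)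
  then show ?thesis using assms(1,3) by (auto simp: forest_packing_def disjoint_family_on_def)
qed

lemma sum_card_update:
  fixes F :: "nat \<Rightarrow> 'e set"
  assumes "i < m"
  shows "(\<Sum>j<m. card ((F(i := K)) j)) + card (F i) = (\<Sum>j<m. card (F j)) + card K"
proof -
  have "(\<Sum>j<m. card ((F(i := K)) j)) = card K + (\<Sum>j\<in>{..<m} - {i}. card (F j))"
    using assms by (simp add: sum.remove[of _ i])
  moreover have "(\<Sum>j<m. card (F j)) = card (F i) + (\<Sum>j\<in>{..<m} - {i}. card (F j))"
    using assms by (simp add: sum.remove[of _ i])
  ultimately show ?thesis by simp
qed

text \<open>Otherwise adding \<open>e\<close> to \<open>F i\<close> would give a larger
  packing.\<close>

lemma maximum_packing_spans:
  assumes "maximum_packing m F" "e \<in> medges G" "\<forall>j<m. e \<notin> F j" "i < m"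
  shows "spans (F i) e"
proof (rule ccontr)
  assume nspan: "\<not> spans (F i) e"
  have F: "forest_packing m F" using assms(1) by (simp add: maximum_packing_def)
  then have Fi: "forest (F i)" using assms(4) by (simp add: forest_packing_def)
  let ?K = "insert e (F i)"
  have "forest_packing m (F(i := ?K))"
    using forest_insert[OF Fi assms(2) nspan] F assms(3,4) by (intro forest_packing_update) auto
  then have "(\<Sum>j<m. card ((F(i := ?K)) j)) \<le> (\<Sum>j<m. card (F j))"
    using assms(1) by (auto simp: maximum_packing_def)
  moreover have "card ?K = Suc (card (F i))"
    using assms(3,4) forest_finite[OF Fi] by simp
  ultimately show False using sum_card_update[OF assms(4), of F ?K] by linarith
qed

section \<open>Exchanging the left-out edge\<close>

text \<open>The last two arguments are the current packing and its left-out edge. As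
  \<open>F i\<close> spans \<open>e\<close> in a maximum packing,
  \<open>\<not> spans (F i - {f}) e\<close> says that \<open>f\<close> lies on the cycle closed by
  \<open>e\<close>.\<close>

inductive exchange_reachable :: "nat \<Rightarrow> (nat \<Rightarrow> 'e set) \<Rightarrow> 'e \<Rightarrow> (nat \<Rightarrow> 'e set) \<Rightarrow> 'e \<Rightarrow> bool"
  for m F0 e0 where
  start: "exchange_reachable m F0 e0 F0 e0"
| exchange: "exchange_reachable m F0 e0 F e \<Longrightarrow> i < m \<Longrightarrow> f \<in> F i \<Longrightarrow> \<not> spans (F i - {f}) e \<Longrightarrow>
    exchange_reachable m F0 e0 (F(i := insert e (F i - {f}))) f"

text \<open>The exchange keeps the size of \<open>F i\<close>, hence maximality; \<open>f\<close>
  was in \<open>F i\<close> alone, so now no forest contains it.\<close>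

lemma maximum_packing_exchange:
  assumes "maximum_packing m F" "e \<in> medges G" "\<forall>j<m. e \<notin> F j"
    and "i < m" "f \<in> F i" "\<not> spans (F i - {f}) e"
  shows "maximum_packing m (F(i := insert e (F i - {f})))"
    and "f \<in> medges G" and "\<forall>j<m. f \<notin> (F(i := insert e (F i - {f}))) j"
proof -
  let ?K = "insert e (F i - {f})"
  have F: "forest_packing m F" using assms(1) by (simp add: maximum_packing_def)
  then have Fi: "forest (F i)" using assms(4) by (simp add: forest_packing_def)
  have "forest (F i - {f})" by (rule forest_subset[OF Fi]) blast
  then have "forest ?K" using assms(2,6) by (rule forest_insert)
  then have "forest_packing m (F(i := ?K))"
    using F assms(3,4) by (intro forest_packing_update) auto
  moreover have "card ?K = card (F i)"
    using assms(3,4,5) forest_finite[OF Fi]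
    by (metis Diff_iff card.remove card_insert_disjoint finite_Diff)
  then have "(\<Sum>j<m. card ((F(i := ?K)) j)) = (\<Sum>j<m. card (F j))"
    using sum_card_update[OF assms(4), of F ?K] by linarith
  ultimately show "maximum_packing m (F(i := ?K))"
    using assms(1) unfolding maximum_packing_def by metis
  show "f \<in> medges G" using Fi assms(5) by (auto simp: forest_def)
  have "f \<notin> F j" if "j < m" "j \<noteq> i" for j
    using F assms(4,5) that by (auto simp: forest_packing_def dest: disjoint_family_onD)
  then show "\<forall>j<m. f \<notin> (F(i := ?K)) j" using assms(3,4,5) by auto
qed

lemma exchange_reachable_maximum:
  assumes "exchange_reachable m F0 e0 F e"
    and "maximum_packing m F0" "e0 \<in> medges G" "\<forall>j<m. e0 \<notin> F0 j"
  shows "maximum_packing m F \<and> e \<in> medges G \<and> (\<forall>j<m. e \<notin> F j)"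
  using assms
proof (induction rule: exchange_reachable.induct)
  case (exchange F e i f)
  then show ?case using maximum_packing_exchange[of m F e i f] by blast
qed blast

text \<open>Over \<open>F - {f}\<close>, each of \<open>e\<close> and \<open>f\<close> spans the
  other.\<close>

lemma conn_exchange:
  assumes "F \<subseteq> medges G" "e \<in> medges G" "f \<in> F" "spans F e" "\<not> spans (F - {f}) e"
  shows "conn (insert e (F - {f})) = conn F"
proof
  show "conn (insert e (F - {f})) \<subseteq> conn F"
    using assms by (intro conn_subset_if_spans) (auto intro: spans_member)
  have "spans (insert e (F - {f})) f"
    by (rule spans_exchange) (use assms in \<open>auto simp: insert_absorb[of f F]\<close>)
  then have "spans (insert e (F - {f})) g" if "g \<in> F" for g
    using that assms(1) by (cases "g = f") (auto intro: spans_member)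
  then show "conn F \<subseteq> conn (insert e (F - {f}))" by (rule conn_subset_if_spans)
qed

text \<open>\<open>F\<close> may be any reachable packing, not only one that leaves out
  \<open>a\<close>; thus one component of \<open>A\<close> serves for every left-out edge.\<close>

lemma exchange_reachable_spans:
  assumes max: "maximum_packing m F0" and e0: "e0 \<in> medges G" "\<forall>j<m. e0 \<notin> F0 j"
  defines "A \<equiv> {a. \<exists>F. exchange_reachable m F0 e0 F a}"
  assumes reach: "exchange_reachable m F0 e0 F e" and "a \<in> A" "i < m"
  shows "spans (F i \<inter> A) a"
proof -
  \<comment> \<open>Every edge of the cycle closed by \<open>b\<close> can be left out next, so it
    lies in \<open>A\<close>.\<close>
  have cycle_in_A: "spans (K i \<inter> A) b" if K: "exchange_reachable m F0 e0 K b" and i: "i < m" for K b i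
  proof -
    have inv: "maximum_packing m K" "b \<in> medges G" "\<forall>j<m. b \<notin> K j"
      using exchange_reachable_maximum[OF K max e0] by auto
    then have "spans (K i) b" using i by (intro maximum_packing_spans)
    moreover have "forest (K i)" using inv(1) i by (simp add: maximum_packing_def forest_packing_def)
    ultimately have "spans {f \<in> K i. \<not> spans (K i - {f}) b} b"
      using inv(2) by (intro fundamental_cycle)
    moreover have "{f \<in> K i. \<not> spans (K i - {f}) b} \<subseteq> K i \<inter> A"
      unfolding A_def using exchange_reachable.exchange[OF K i] by blast
    ultimately show ?thesis by (rule spans_mono)
  qed
  have const: "conn (K i \<inter> A) = conn (F0 i \<inter> A)" if "exchange_reachable m F0 e0 K b" for K b
    using that
  proof (induction rule: exchange_reachable.induct)
    case (exchange K b j f)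
    show ?case
    proof (cases "j = i")
      case True
      have reach: "exchange_reachable m F0 e0 (K(j := insert b (K j - {f}))) f"
        using exchange.hyps by (rule exchange_reachable.exchange)
      then have "f \<in> A" "b \<in> A" unfolding A_def using exchange.hyps by blast+
      have inv: "maximum_packing m K" "b \<in> medges G"
        using exchange_reachable_maximum[OF exchange.hyps(1) max e0] by auto
      then have sub: "K i \<inter> A \<subseteq> medges G"
        using \<open>i < m\<close> by (auto simp: maximum_packing_def forest_packing_def forest_def)
      \<comment> \<open>\<open>f\<close> remains indispensable after restriction to
        \<open>A\<close>, so \<open>conn_exchange\<close> applies to \<open>K i \<inter> A\<close>
        itself.\<close>
      have "\<not> spans (K i \<inter> A - {f}) b"
        using exchange.hyps(4) True spans_mono[of "K i \<inter> A - {f}" b "K i - {f}"] by blast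
      then have "conn (insert b (K i \<inter> A - {f})) = conn (K i \<inter> A)"
        using sub inv(2) cycle_in_A[OF exchange.hyps(1) \<open>i < m\<close>] exchange.hyps(3) True \<open>f \<in> A\<close>
        by (intro conn_exchange) auto
      moreover have "insert b (K i - {f}) \<inter> A = insert b (K i \<inter> A - {f})"
        using \<open>b \<in> A\<close> by blast
      ultimately show ?thesis using exchange.IH True by simp
    qed (use exchange.IH in simp)
  qed simp
  \<comment> \<open>At a stage \<open>K\<close> that leaves out \<open>a\<close>, the edge is
    spanned inside \<open>A\<close>; comparing both stages with \<open>F0\<close> carries this over
    to \<open>F\<close>.\<close>
  obtain K where K: "exchange_reachable m F0 e0 K a" using \<open>a \<in> A\<close> by (auto simp: A_def)
  then show ?thesis
    using cycle_in_A[OF K \<open>i < m\<close>] const[OF K] const[OF reach] by (simp add: spans_def)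
qed

section \<open>From forests to trees on a component\<close>

text \<open>A walk in \<open>F\<close> from \<open>u\<close> never leaves the component of
  \<open>u\<close> in \<open>A\<close>, so a forest can be cut down to that component without losing
  connections there.\<close>

lemma conn_within_component:
  assumes "(u, v) \<in> conn F" "F \<subseteq> A"
  shows "(u, v) \<in> conn {e \<in> F. mends G e \<subseteq> conn A `` {u}}"
  using assms(1)
proof (induction rule: conn_induct)
  case (step x y e)
  have "(u, x) \<in> conn A" by (rule subsetD[OF conn_mono[OF assms(2)] step.hyps(1)])
  moreover have "(x, y) \<in> conn A" using step.hyps(2,3) assms(2) by (blast intro: conn_edge)
  ultimately have "mends G e \<subseteq> conn A `` {u}" using step.hyps(3) conn_trans[of u x A y] by auto
  then have "(x, y) \<in> conn {e \<in> F. mends G e \<subseteq> conn A `` {u}}"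
    using step.hyps by (intro conn_edge[of e]) auto
  with step.IH show ?case by (rule conn_trans)
qed simp

text \<open>Following the cycle from its first to its last vertex avoids the last edge, which is
  therefore spanned by the others.\<close>

lemma forest_no_cycle:
  assumes "forest F"
  shows "\<not> mg_cycle \<lparr>mverts = X, medges = F, mends = mends G\<rparr> vs es"
proof
  assume "mg_cycle \<lparr>mverts = X, medges = F, mends = mends G\<rparr> vs es"
  then have len: "2 \<le> length vs" "length es = length vs" and dist: "distinct es"
    and es: "set es \<subseteq> F"
    and ends: "\<And>i. i < length vs \<Longrightarrow> mends G (es ! i) = {vs ! i, vs ! (Suc i mod length vs)}"
    by (auto simp: mg_cycle_def)
  \<comment> \<open>The last index: \<open>Suc n mod length vs\<close> is 0, so
    \<open>es ! n\<close> leads back to \<open>vs ! 0\<close>.\<close>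
  define n where "n = length vs - 1"
  have n: "length vs = Suc n" using len(1) by (simp add: n_def)
  let ?f = "es ! n"
  have "(vs ! 0, vs ! k) \<in> conn (F - {?f})" if "k \<le> n" for k
    using that
  proof (induction k)
    case (Suc k)
    have "es ! k \<in> F - {?f}"
      using Suc.prems es len n dist by (auto simp: nth_eq_iff_index_eq)
    moreover have "mends G (es ! k) = {vs ! k, vs ! Suc k}"
      using ends[of k] Suc.prems n by simp
    ultimately have "(vs ! k, vs ! Suc k) \<in> conn (F - {?f})" by (rule conn_edge)
    with Suc.IH Suc.prems show ?case using conn_trans[of "vs ! 0" "vs ! k"] by simp
  qed simp
  then have "(vs ! n, vs ! 0) \<in> conn (F - {?f})" by (blast intro: conn_sym)
  moreover have "mends G ?f = {vs ! n, vs ! 0}" using ends[of n] n by simp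
  ultimately have "spans (F - {?f}) ?f" by (simp add: spans_iff)
  moreover have "?f \<in> F" using es len(2) n by auto
  ultimately show False using assms by (auto simp: forest_def)
qed

lemma multigraph_restrict:
  assumes "X \<subseteq> mverts G" "F \<subseteq> medges G" "\<And>e. e \<in> F \<Longrightarrow> mends G e \<subseteq> X"
  shows "multigraph \<lparr>mverts = X, medges = F, mends = mends G\<rparr>"
  using assms finite_mverts finite_medges no_loops
  by unfold_locales (auto intro: finite_subset)

lemma conn_eq_mg_adj: "conn F = (mg_adj \<lparr>mverts = X, medges = F, mends = mends G\<rparr>)\<^sup>*"
  by (simp add: conn_def mg_adj_def)

lemma forest_is_tree:
  assumes "forest F" "X \<subseteq> mverts G" "\<And>e. e \<in> F \<Longrightarrow> mends G e \<subseteq> X"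
    and "u \<in> X" "\<And>v. v \<in> X \<Longrightarrow> (u, v) \<in> conn F"
  shows "mg_tree \<lparr>mverts = X, medges = F, mends = mends G\<rparr>"
proof -
  have "F \<subseteq> medges G" using assms(1) by (simp add: forest_def)
  then have "multigraph \<lparr>mverts = X, medges = F, mends = mends G\<rparr>"
    using assms(2,3) by (intro multigraph_restrict)
  moreover have "(v, w) \<in> conn F" if "v \<in> X" "w \<in> X" for v w
    using conn_trans[OF conn_sym] assms(5) that by blast
  then have "mg_connected \<lparr>mverts = X, medges = F, mends = mends G\<rparr>"
    using assms(4) unfolding mg_connected_def conn_eq_mg_adj[of F X] by auto
  ultimately show ?thesis using forest_no_cycle[OF assms(1)] by (auto simp: mg_tree_def)
qed

section \<open>Construction of the subgraph\<close>

lemma ex_unpacked_edge: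
  assumes "forest_packing m F" "mverts G \<noteq> {}" "card (medges G) > m * (card (mverts G) - 1)"
  shows "\<exists>e\<in>medges G. \<forall>i<m. e \<notin> F i"
proof (rule ccontr)
  assume "\<not> ?thesis"
  then have "medges G \<subseteq> (\<Union>i<m. F i)" by blast
  moreover have "finite (\<Union>i<m. F i)"
    using assms(1) forest_finite by (auto simp: forest_packing_def)
  ultimately have "card (medges G) \<le> card (\<Union>i<m. F i)" by (metis card_mono)
  also have "\<dots> \<le> (\<Sum>i<m. card (F i))" by (rule card_UN_le) simp
  also have "\<dots> \<le> m * (card (mverts G) - 1)" using assms(1,2) by (rule packing_size_le)
  finally show False using assms(3) by simp
qed

lemma ex_plus_tree_connected_subgraph:
  assumes "mverts G \<noteq> {}" "card (medges G) > m * (card (mverts G) - 1)"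
  shows "\<exists>H. mg_subgraph H G \<and> card (mverts H) \<ge> 2 \<and> plus_tree_connected m H"
proof -
  obtain F0 where max: "maximum_packing m F0" using ex_maximum_packing[OF assms(1)] by blast
  then obtain e0 where e0: "e0 \<in> medges G" "\<forall>i<m. e0 \<notin> F0 i"
    using ex_unpacked_edge assms by (metis maximum_packing_def)
  define A where "A = {a. \<exists>F. exchange_reachable m F0 e0 F a}"
  have A_sub: "A \<subseteq> medges G"
    unfolding A_def using exchange_reachable_maximum[OF _ max e0] by blast
  have "e0 \<in> A" unfolding A_def using exchange_reachable.start by blast
  obtain u v where uv: "mends G e0 = {u, v}" "u \<noteq> v" "u \<in> mverts G"
    using edge_ends[OF e0(1)] .
  define X where "X = conn A `` {u}"
  \<comment> \<open>\<open>conn\<close> lives on the whole vertex type; walks stay in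
    \<open>mverts G\<close> because they start at \<open>u\<close> and follow edges of
    \<open>G\<close>.\<close>
  have "w \<in> mverts G" if "(u, w) \<in> conn A" for w
    using that
  proof (induction rule: conn_induct)
    case (step x y e)
    then show ?case using mends_subset[of e] A_sub by auto
  qed (rule uv)
  then have X_sub: "X \<subseteq> mverts G" by (auto simp: X_def)
  have "u \<in> X" "v \<in> X" using conn_edge[OF \<open>e0 \<in> A\<close> uv(1)] by (auto simp: X_def)
  define B where "B = {a \<in> A. mends G a \<subseteq> X}"
  have "e0 \<in> B" using \<open>e0 \<in> A\<close> \<open>u \<in> X\<close> \<open>v \<in> X\<close> uv by (auto simp: B_def)
  have "B \<subseteq> medges G" using A_sub by (auto simp: B_def)
  define H where "H = \<lparr>mverts = X, medges = B, mends = mends G\<rparr>"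
  have H: "multigraph H"
    unfolding H_def using X_sub \<open>B \<subseteq> medges G\<close> by (intro multigraph_restrict) (auto simp: B_def)
  then have "mg_subgraph H G"
    using X_sub \<open>B \<subseteq> medges G\<close> multigraph_axioms by (auto simp: mg_subgraph_def H_def)
  \<comment> \<open>The ends of \<open>e0\<close>, which is no loop, supply two vertices.\<close>
  moreover have "card {u, v} \<le> card X"
    using \<open>u \<in> X\<close> \<open>v \<in> X\<close> X_sub finite_mverts finite_subset by (intro card_mono) auto
  then have "card (mverts H) \<ge> 2" using uv(2) by (simp add: H_def)
  moreover have "tree_connected m (mg_del_edge H e)" if "e \<in> medges H" for e
  proof -
    have "e \<in> A" using that by (simp add: H_def B_def)
    \<comment> \<open>A stage that leaves out \<open>e\<close>: its forests, restricted to
      \<open>B\<close>, become the trees avoiding \<open>e\<close>.\<close>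
    then obtain F where F: "exchange_reachable m F0 e0 F e" by (auto simp: A_def)
    have inv: "maximum_packing m F" "\<forall>i<m. e \<notin> F i"
      using exchange_reachable_maximum[OF F max e0] by auto
    define T where "T i = \<lparr>mverts = X, medges = F i \<inter> B, mends = mends G\<rparr>" for i
    have del: "mg_del_edge H e = \<lparr>mverts = X, medges = B - {e}, mends = mends G\<rparr>"
      by (simp add: mg_del_edge_def H_def)
    then have "multigraph (mg_del_edge H e)"
      unfolding del using X_sub \<open>B \<subseteq> medges G\<close>
      by (intro multigraph_restrict) (auto simp: B_def)
    moreover have "mg_tree (T i)" if "i < m" for i
      unfolding T_def
    proof (rule forest_is_tree)
      show "forest (F i \<inter> B)"
        using inv(1) that by (auto simp: maximum_packing_def forest_packing_def intro: forest_subset)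
      show "X \<subseteq> mverts G" "u \<in> X" by fact+
      show "mends G f \<subseteq> X" if "f \<in> F i \<inter> B" for f using that by (simp add: B_def)
      \<comment> \<open>Each edge of \<open>A\<close> is spanned by \<open>F i \<inter> A\<close>,
        so every vertex of \<open>X\<close> is reached from \<open>u\<close> within this
        forest.\<close>
      have "conn A \<subseteq> conn (F i \<inter> A)"
        using exchange_reachable_spans[OF max e0 F] that
        by (intro conn_subset_if_spans) (simp add: A_def)
      moreover have "F i \<inter> B = {f \<in> F i \<inter> A. mends G f \<subseteq> conn A `` {u}}"
        by (auto simp: B_def X_def)
      ultimately show "(u, w) \<in> conn (F i \<inter> B)" if "w \<in> X" for w
        using that conn_within_component[of u w "F i \<inter> A" A] by (auto simp: X_def)
    qed
    ultimately have "\<forall>i<m. mg_spanning_tree (T i) (mg_del_edge H e)"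
      using inv(2) unfolding mg_spanning_tree_def mg_subgraph_def del mg_tree_def
      by (auto simp: T_def)
    moreover have "disjoint_family_on (\<lambda>i. medges (T i)) {..<m}"
      using inv(1)
      by (auto simp: T_def maximum_packing_def forest_packing_def disjoint_family_on_def)
    ultimately show ?thesis by (auto simp: tree_connected_def)
  qed
  ultimately show ?thesis
    using \<open>e0 \<in> B\<close> by (auto simp: plus_tree_connected_def H_def)
qed

end

theorem theorem2p9:
  fixes m :: nat and G :: "('v, 'e) mgraph"
  assumes "m \<ge> 1"
    and "multigraph G"
    and "card (mverts G) \<ge> 2"
    and "card (medges G) \<ge> m * (card (mverts G) - 1) + 1"
  shows "\<exists>H. mg_subgraph H G \<and> card (mverts H) \<ge> 2 \<and> plus_tree_connected m H"
proof -
  interpret multigraph G by fact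
  show ?thesis using assms(3,4) by (intro ex_plus_tree_connected_subgraph) auto
qed

end
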